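(* Let $G$ be a connected chordal graph with positive edge lengths and let $S,T$ be distinct vertices. Two different normal separator paths in $G$ do not share a common edge.
   Context: A chordal graph is a simple undirected graph in which every cycle with four or more vertices has a chord. Edge lengths are $L(u,v)$; it is assumed that no two different paths between the same ordered pair of vertices have the same length. A path $p=p_0,\dots,p_{|p|-1}$ is a sequence of vertices with consecutive vertices adjacent; its length $\|p\|$ is the sum of the lengths of its edges; it is simple if its vertices are distinct; $p_{i,j}$ is the subpath $p_i,\dots,p_j$; $p$ contains $q$ if $q=p_{i,j}$ for some $i\le j$. Two paths are different if they differ as sequences. A path is separating if removing all its edges disconnects $G$. A separator path is a simple separating path not containing any separating path other than itself. A separator path $r$ is traversable if some simple path from $S$ to $T$ contains $r$; useful if $\|r_{i,i+2}\|<L(r_i,r_{i+2})$ for all $0\le i<|r|-2$ (these edges exist for separator paths); normal if it is traversable, useful, and has more than two edges. *)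

theory Defs
  imports Complex_Main
begin

text \<open>
  A graph is given by its vertex set \<open>V\<close> and its set \<open>E\<close> of undirected edges, each edge being a
  two-element subset of \<open>V\<close>. Edge lengths are a function on edges, so that the length of the edge
  between \<open>u\<close> and \<open>v\<close> is \<open>L {u, v}\<close>, which does not depend on the order of the endpoints.
\<close>

definition simple_graph :: "'a set \<Rightarrow> 'a set set \<Rightarrow> bool" where
  "simple_graph V E \<longleftrightarrow> (\<forall>e\<in>E. e \<subseteq> V \<and> card e = 2)"

definition is_path :: "'a set \<Rightarrow> 'a set set \<Rightarrow> 'a list \<Rightarrow> bool" where
  "is_path V E p \<longleftrightarrow>
     p \<noteq> [] \<and> set p \<subseteq> V \<and> (\<forall>i. Suc i < length p \<longrightarrow> {p ! i, p ! Suc i} \<in> E)"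

definition simple_path :: "'a set \<Rightarrow> 'a set set \<Rightarrow> 'a list \<Rightarrow> bool" where
  "simple_path V E p \<longleftrightarrow> is_path V E p \<and> distinct p"

definition path_edges :: "'a list \<Rightarrow> 'a set set" where
  "path_edges p = {{p ! i, p ! Suc i} | i. Suc i < length p}"

definition path_length :: "('a set \<Rightarrow> real) \<Rightarrow> 'a list \<Rightarrow> real" where
  "path_length L p = (\<Sum>i<length p - 1. L {p ! i, p ! Suc i})"

text \<open>\<open>subpath p i j\<close> is the sequence of the entries of \<open>p\<close> with indices \<open>i, \<dots>, j\<close>, both included.\<close>

definition subpath :: "'a list \<Rightarrow> nat \<Rightarrow> nat \<Rightarrow> 'a list" where
  "subpath p i j = map ((!) p) [i..<Suc j]"

definition contains_path :: "'a list \<Rightarrow> 'a list \<Rightarrow> bool" where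
  "contains_path p q \<longleftrightarrow> (\<exists>i j. i \<le> j \<and> j < length p \<and> q = subpath p i j)"

definition connected_graph :: "'a set \<Rightarrow> 'a set set \<Rightarrow> bool" where
  "connected_graph V E \<longleftrightarrow>
     V \<noteq> {} \<and> (\<forall>u\<in>V. \<forall>v\<in>V. \<exists>p. is_path V E p \<and> hd p = u \<and> last p = v)"

text \<open>
  A cycle is given by its distinct vertices in cyclic order, without repeating the first one at the
  end. A chord is an edge between two vertices of the cycle that is not an edge of the cycle.
\<close>

definition is_cycle :: "'a set \<Rightarrow> 'a set set \<Rightarrow> 'a list \<Rightarrow> bool" where
  "is_cycle V E c \<longleftrightarrow> 3 \<le> length c \<and> distinct c \<and> is_path V E (c @ [hd c])"

definition has_chord :: "'a set set \<Rightarrow> 'a list \<Rightarrow> bool" where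
  "has_chord E c \<longleftrightarrow>
     (\<exists>u\<in>set c. \<exists>v\<in>set c. {u, v} \<in> E \<and> {u, v} \<notin> path_edges (c @ [hd c]))"

definition chordal_graph :: "'a set \<Rightarrow> 'a set set \<Rightarrow> bool" where
  "chordal_graph V E \<longleftrightarrow>
     simple_graph V E \<and> (\<forall>c. is_cycle V E c \<and> 4 \<le> length c \<longrightarrow> has_chord E c)"

text \<open>
  The standing genericity assumption on lengths is imposed on simple paths. Imposed on all vertex
  sequences it would be contradictory as soon as some vertex \<open>u\<close> has two distinct neighbours
  \<open>v, w\<close>: the sequences \<open>u, v, u, w, u\<close> and \<open>u, w, u, v, u\<close> have the same length.
\<close>

definition unique_path_lengths :: "'a set \<Rightarrow> 'a set set \<Rightarrow> ('a set \<Rightarrow> real) \<Rightarrow> bool" where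
  "unique_path_lengths V E L \<longleftrightarrow>
     (\<forall>p q. simple_path V E p \<and> simple_path V E q \<and> hd p = hd q \<and> last p = last q \<and> p \<noteq> q
        \<longrightarrow> path_length L p \<noteq> path_length L q)"

definition separating :: "'a set \<Rightarrow> 'a set set \<Rightarrow> 'a list \<Rightarrow> bool" where
  "separating V E p \<longleftrightarrow> is_path V E p \<and> \<not> connected_graph V (E - path_edges p)"

definition separator_path :: "'a set \<Rightarrow> 'a set set \<Rightarrow> 'a list \<Rightarrow> bool" where
  "separator_path V E r \<longleftrightarrow>
     simple_path V E r \<and> separating V E r \<and>
     (\<forall>q. contains_path r q \<and> separating V E q \<longrightarrow> q = r)"

definition traversable :: "'a set \<Rightarrow> 'a set set \<Rightarrow> 'a \<Rightarrow> 'a \<Rightarrow> 'a list \<Rightarrow> bool" where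
  "traversable V E S T r \<longleftrightarrow>
     (\<exists>p. simple_path V E p \<and> hd p = S \<and> last p = T \<and> contains_path p r)"

text \<open>
  Used only for separator paths \<open>r\<close> of connected chordal graphs, for which the sets
  \<open>{r ! i, r ! (i + 2)}\<close> are edges.
\<close>

definition useful :: "('a set \<Rightarrow> real) \<Rightarrow> 'a list \<Rightarrow> bool" where
  "useful L r \<longleftrightarrow>
     (\<forall>i. i + 2 < length r \<longrightarrow> path_length L (subpath r i (i + 2)) < L {r ! i, r ! (i + 2)})"

text \<open>A path with \<open>n\<close> edges has \<open>n + 1\<close> entries.\<close>

definition normal_separator_path ::
  "'a set \<Rightarrow> 'a set set \<Rightarrow> ('a set \<Rightarrow> real) \<Rightarrow> 'a \<Rightarrow> 'a \<Rightarrow> 'a list \<Rightarrow> bool" where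
  "normal_separator_path V E L S T r \<longleftrightarrow>
     separator_path V E r \<and> traversable V E S T r \<and> useful L r \<and> 2 < length r - 1"

end

theory Submission
  imports Defs
begin

text \<open>A separator path \<open>r\<close> consists exactly of the edges crossing a cut \<open>(A, V - A)\<close> with connected
  sides. By chordality, for every partition of the crossing edges into two nonempty classes some
  triangle contains an edge of each class; hence consecutive edges of \<open>r\<close> lie in a common triangle.
  If \<open>q\<close> and \<open>r\<close> share an edge, usefulness propagates this along the triangles, so that \<open>q\<close> and \<open>r\<close>
  have the same edges and \<open>q\<close> is the reversal of \<open>r\<close>. If both directions are traversable, then the
  ends of \<open>r\<close> are joined through \<open>S\<close> avoiding the interior of \<open>r\<close>, and the same triangle
  argument would put the first and the last edge of \<open>r\<close> into a common triangle, which is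
  impossible for at least three edges.\<close>

section \<open>Reachability and the edges of paths\<close>

text \<open>Both ends of every step must lie in the first argument, so \<open>conn A E\<close> is
  reachability in the subgraph induced on \<open>A\<close>. Being a reflexive closure, it relates a
  vertex outside that set to itself, hence the membership facts carried along separately.\<close>

definition conn :: "'a set \<Rightarrow> 'a set set \<Rightarrow> 'a \<Rightarrow> 'a \<Rightarrow> bool" where
  "conn V E = (\<lambda>u v. u \<in> V \<and> v \<in> V \<and> {u, v} \<in> E)\<^sup>*\<^sup>*"

lemma conn_refl [simp]: "conn V E u u"
  by (simp add: conn_def)

lemma conn_trans: "conn V E u v \<Longrightarrow> conn V E v w \<Longrightarrow> conn V E u w"
  unfolding conn_def by (rule rtranclp_trans)

lemma conn_sym: "conn V E u v \<Longrightarrow> conn V E v u"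
  unfolding conn_def
  by (rule sympD[OF symp_rtranclp]) (auto simp: symp_def insert_commute)

lemma conn_edge: "{u, v} \<in> E \<Longrightarrow> u \<in> V \<Longrightarrow> v \<in> V \<Longrightarrow> conn V E u v"
  unfolding conn_def by blast

lemma conn_induct [consumes 1, case_names refl step]:
  assumes "conn V E u v" "P u"
    and "\<And>x y. conn V E u x \<Longrightarrow> x \<in> V \<Longrightarrow> y \<in> V \<Longrightarrow> {x, y} \<in> E \<Longrightarrow> P x \<Longrightarrow> P y"
  shows "P v"
  using assms(1)[unfolded conn_def] assms(2)
  by (induction rule: rtranclp_induct) (use assms(3)[unfolded conn_def] in blast)+

lemma is_path_successively:
  "is_path V E p \<longleftrightarrow> p \<noteq> [] \<and> set p \<subseteq> V \<and> successively (\<lambda>u v. {u, v} \<in> E) p"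
  by (auto simp: is_path_def successively_conv_nth)

lemma is_path_imp_conn: "is_path V E p \<Longrightarrow> conn V E (hd p) (last p)"
proof (induction p)
  case (Cons x p)
  show ?case
  proof (cases p)
    case (Cons y ys)
    then have "conn V E x y" "conn V E (hd p) (last p)"
      using Cons.prems Cons.IH by (auto intro: conn_edge simp: is_path_successively)
    then show ?thesis
      using Cons by (auto intro: conn_trans)
  qed simp
qed (simp add: is_path_def)

lemma conn_iff_path:
  assumes "u \<in> V"
  shows "conn V E u v \<longleftrightarrow> (\<exists>p. is_path V E p \<and> hd p = u \<and> last p = v)"
proof
  assume "conn V E u v"
  then show "\<exists>p. is_path V E p \<and> hd p = u \<and> last p = v"
  proof (induction rule: conn_induct)
    case refl
    then show ?case
      using assms by (intro exI[of _ "[u]"]) (simp add: is_path_successively)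
  next
    case (step x y)
    then obtain p where "is_path V E p" "hd p = u" "last p = x" by blast
    then show ?case
      using step by (intro exI[of _ "p @ [y]"]) (auto simp: is_path_successively successively_append_iff)
  qed
qed (use is_path_imp_conn in blast)

lemma connected_graph_iff_conn:
  "connected_graph V E \<longleftrightarrow> V \<noteq> {} \<and> (\<forall>u\<in>V. \<forall>v\<in>V. conn V E u v)"
  by (auto simp: connected_graph_def conn_iff_path)

text \<open>Splitting the list at an edge spares index arithmetic when lists are appended or
  reversed.\<close>

lemma path_edges_iff:
  "e \<in> path_edges p \<longleftrightarrow> (\<exists>xs u v ys. p = xs @ u # v # ys \<and> e = {u, v})"
proof
  assume "e \<in> path_edges p"
  then obtain i where i: "Suc i < length p" "e = {p ! i, p ! Suc i}"
    by (auto simp: path_edges_def)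
  then have "p = take i p @ p ! i # p ! Suc i # drop (Suc (Suc i)) p"
    by (metis Cons_nth_drop_Suc Suc_lessD append_take_drop_id)
  with i show "\<exists>xs u v ys. p = xs @ u # v # ys \<and> e = {u, v}" by blast
next
  assume "\<exists>xs u v ys. p = xs @ u # v # ys \<and> e = {u, v}"
  then obtain xs u v ys where "p = xs @ u # v # ys" "e = {u, v}" by blast
  then show "e \<in> path_edges p"
    unfolding path_edges_def by (auto simp: nth_append intro!: exI[of _ "length xs"])
qed

lemma path_edges_nth: "Suc i < length p \<Longrightarrow> {p ! i, p ! Suc i} \<in> path_edges p"
  by (auto simp: path_edges_def)

lemma path_edges_Cons_Cons:
  "path_edges (x # y # p) = insert {x, y} (path_edges (y # p))"
proof -
  have "path_edges q = (\<lambda>i. {q ! i, q ! Suc i}) ` {..<length q - 1}" for q :: "'a list"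
    by (auto simp: path_edges_def)
  then show ?thesis
    by (simp add: lessThan_Suc_eq_insert_0 image_image)
qed

lemma path_edges_append_subset: "path_edges p \<subseteq> path_edges (xs @ p @ ys)"
proof
  fix e assume "e \<in> path_edges p"
  then obtain as u v bs where "p = as @ u # v # bs" "e = {u, v}"
    by (auto simp: path_edges_iff)
  then show "e \<in> path_edges (xs @ p @ ys)"
    by (auto simp: path_edges_iff intro!: exI[of _ "xs @ as"])
qed

lemma path_edges_rev_subset: "path_edges p \<subseteq> path_edges (rev p)"
proof
  fix e assume "e \<in> path_edges p"
  then obtain as u v bs where "p = as @ u # v # bs" "e = {u, v}"
    by (auto simp: path_edges_iff)
  then have "rev p = rev bs @ v # u # rev as" "e = {v, u}" by auto
  then show "e \<in> path_edges (rev p)" unfolding path_edges_iff by blast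
qed

lemma path_edges_rev [simp]: "path_edges (rev p) = path_edges p"
  using path_edges_rev_subset[of p] path_edges_rev_subset[of "rev p"] by auto

lemma path_edges_subset_set: "e \<in> path_edges p \<Longrightarrow> e \<subseteq> set p"
  by (auto simp: path_edges_iff)

lemma is_path_edges: "is_path V E p \<Longrightarrow> path_edges p \<subseteq> E"
  by (auto simp: is_path_def path_edges_def)

section \<open>Triangles meeting both classes of a cut\<close>

text \<open>The chord bypasses the stretch between its ends, which is nonempty because the chord is
  not an edge of \<open>P\<close>. As the ends of \<open>P\<close> survive, the result can replace
  \<open>P\<close> in a minimal configuration.\<close>

lemma shorten_chord:
  assumes "is_path A E P" "u \<in> set P" "v \<in> set P" "u \<noteq> v" "{u, v} \<in> E" "{u, v} \<notin> path_edges P"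
  shows "\<exists>P'. is_path A E P' \<and> hd P' = hd P \<and> last P' = last P \<and> length P' < length P"
proof -
  obtain x y xs ys zs where P: "P = xs @ x # ys @ y # zs" and xy: "{x, y} = {u, v}"
  proof -
    obtain xs ys where 1: "P = xs @ u # ys" using assms(2) by (meson split_list)
    then have "v \<in> set xs \<or> v \<in> set ys" using assms by auto
    then show thesis
    proof
      assume "v \<in> set xs"
      then obtain as bs where "xs = as @ v # bs" by (meson split_list)
      with 1 that[of as v bs u ys] show thesis by auto
    next
      assume "v \<in> set ys"
      then obtain as bs where "ys = as @ v # bs" by (meson split_list)
      with 1 that[of xs u as v bs] show thesis by auto
    qed
  qed
  have "ys \<noteq> []"
    using assms(6) unfolding path_edges_iff P xy[symmetric] by (metis append_Nil)
  moreover have "is_path A E (xs @ x # y # zs)"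
    using assms(1,5) P xy by (auto simp: is_path_successively successively_append_iff successively_Cons)
  ultimately show ?thesis
    using P by (intro exI[of _ "xs @ x # y # zs"]) (auto simp: hd_append)
qed

lemma shorten_loop:
  assumes "is_path A E P" "\<not> distinct P"
  shows "\<exists>P'. is_path A E P' \<and> hd P' = hd P \<and> last P' = last P \<and> length P' < length P"
proof -
  obtain xs ys zs x where P: "P = xs @ [x] @ ys @ [x] @ zs"
    using not_distinct_decomp[OF assms(2)] by blast
  then have "is_path A E (xs @ x # zs)"
    using assms(1) by (auto simp: is_path_successively successively_append_iff successively_Cons)
  then show ?thesis
    using P by (intro exI[of _ "xs @ x # zs"]) (auto simp: hd_append)
qed

text \<open>A shortest cycle made of a path in \<open>A\<close>, a path in \<open>B\<close>, an edge of \<open>F1\<close> and an edge of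
  \<open>F2\<close> is a triangle, because a chord would give a shorter such cycle.\<close>

lemma bond_triangle:
  assumes chordal: "chordal_graph V E" and AB: "A \<subseteq> V" "B \<subseteq> V" "A \<inter> B = {}"
    and F: "F1 \<subseteq> E" "F2 \<subseteq> E" "F1 \<inter> F2 = {}"
    and cross: "\<And>x y. x \<in> A \<Longrightarrow> y \<in> B \<Longrightarrow> {x, y} \<in> E \<Longrightarrow> {x, y} \<in> F1 \<union> F2"
    and ab: "a \<in> A" "b \<in> B" "conn A E a a'" "conn B E b b'" "{a, b} \<in> F1" "{a', b'} \<in> F2"
  shows "\<exists>x y z. {x, y} \<in> F1 \<and> {x, z} \<in> F2 \<and> {y, z} \<in> E"
proof -
  \<comment> \<open>The heads of \<open>P\<close> and \<open>Q\<close> are joined by an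
    \<open>F1\<close> edge and their last vertices by an \<open>F2\<close> edge, so
    \<open>P @ rev Q\<close> closes up to a cycle once it has enough vertices. The total number of
    vertices is minimised.\<close>
  define good where "good = (\<lambda>(P, Q). is_path A E P \<and> is_path B E Q \<and>
    {hd P, hd Q} \<in> F1 \<and> {last P, last Q} \<in> F2)"
  define m where "m = (\<lambda>(P :: 'a list, Q :: 'a list). length P + length Q)"
  have "\<exists>PQ. good PQ"
    using ab by (auto simp: conn_iff_path good_def)
  then obtain PQ where "is_arg_min m good PQ"
    by (metis ex_has_least_nat is_arg_min_linorder)
  then obtain P Q where PQ: "good (P, Q)"
      and min: "\<And>P' Q'. good (P', Q') \<Longrightarrow> length P + length Q \<le> length P' + length Q'"
    by (cases PQ) (auto simp: is_arg_min_linorder m_def)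
  have P: "is_path A E P" and Q: "is_path B E Q" and F1: "{hd P, hd Q} \<in> F1"
      and F2: "{last P, last Q} \<in> F2"
    using PQ by (auto simp: good_def)
  have ne: "P \<noteq> []" "Q \<noteq> []" and sets: "set P \<subseteq> A" "set Q \<subseteq> B"
    using P Q by (auto simp: is_path_def)
  have minP: "\<not> (\<exists>P'. is_path A E P' \<and> hd P' = hd P \<and> last P' = last P \<and> length P' < length P)"
    using PQ min unfolding good_def by fastforce
  have minQ: "\<not> (\<exists>P'. is_path B E P' \<and> hd P' = hd Q \<and> last P' = last Q \<and> length P' < length Q)"
    using PQ min unfolding good_def by fastforce
  have card2: "card e = 2" if "e \<in> E" for e
    using that chordal by (auto simp: chordal_graph_def simple_graph_def)
  have "length P + length Q < 4"
  proof (rule ccontr)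
    assume "\<not> ?thesis"
    then have len: "4 \<le> length (P @ rev Q)" by simp
    let ?c = "P @ rev Q"
    have hdc: "hd ?c = hd P" using ne by simp
    have "hd P \<in> V" using hd_in_set[OF ne(1)] sets AB by blast
    then have "is_path V E (?c @ [hd ?c])"
      using P Q F1 F2 ne AB F(1,2) unfolding hdc
      by (auto simp: is_path_successively successively_append_iff hd_append hd_rev last_rev
          insert_commute)
    moreover have "distinct ?c"
      using minP minQ shorten_loop[OF P] shorten_loop[OF Q] sets AB(3) by auto
    ultimately have "is_cycle V E ?c"
      using len by (auto simp: is_cycle_def)
    then have "has_chord E ?c"
      using chordal len by (auto simp: chordal_graph_def)
    then obtain u v where uv: "u \<in> set ?c" "v \<in> set ?c" "{u, v} \<in> E"
        and nc: "{u, v} \<notin> path_edges (?c @ [hd ?c])"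
      unfolding has_chord_def by blast
    have "u \<noteq> v" using card2[OF uv(3)] by auto
    have nP: "{u, v} \<notin> path_edges P"
      using nc path_edges_append_subset[of P "[]" "rev Q @ [hd ?c]"] by auto
    have nQ: "{u, v} \<notin> path_edges Q"
      using nc path_edges_append_subset[of "rev Q" "P" "[hd ?c]"] by auto
    \<comment> \<open>A chord from \<open>P\<close> to \<open>Q\<close> lies in \<open>F1\<close> or
      \<open>F2\<close> and can take over the role of that closing edge, leaving two suffixes or two
      prefixes. Minimality says that nothing was cut off, so the chord was the closing edge
      itself.\<close>
    have no: False if xy: "x \<in> set P" "y \<in> set Q" "{x, y} = {u, v}" for x y
    proof -
      obtain ps ps' where Ps: "P = ps @ x # ps'" using xy(1) by (meson split_list)
      obtain qs qs' where Qs: "Q = qs @ y # qs'" using xy(2) by (meson split_list)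
      have "{x, y} \<in> E" using xy(3) uv(3) by simp
      then have "{x, y} \<in> F1 \<union> F2" using cross xy(1,2) sets by blast
      then show False
      proof
        assume "{x, y} \<in> F1"
        then have "good (x # ps', y # qs')"
          using P Q F2 Ps Qs by (auto simp: good_def is_path_successively successively_append_iff)
        from min[OF this] have "ps = []" "qs = []" using Ps Qs by auto
        then have "?c @ [hd ?c] = (P @ rev qs') @ y # x # []"
          using Ps Qs by auto
        then show False using nc xy(3) unfolding path_edges_iff by (metis insert_commute)
      next
        assume "{x, y} \<in> F2"
        then have "good (ps @ [x], qs @ [y])"
          using P Q F1 Ps Qs
          by (auto simp: good_def is_path_successively successively_append_iff hd_append split: if_splits)
        from min[OF this] have "ps' = []" "qs' = []" using Ps Qs by auto
        then have "?c @ [hd ?c] = ps @ x # y # (rev qs @ [hd ?c])"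
          using Ps Qs by auto
        then show False using nc xy(3) unfolding path_edges_iff by metis
      qed
    qed
    show False
      using uv no[of u v] no[of v u] shorten_chord[OF P _ _ \<open>u \<noteq> v\<close> uv(3) nP]
        shorten_chord[OF Q _ _ \<open>u \<noteq> v\<close> uv(3) nQ] minP minQ by (auto simp: insert_commute)
  qed
  \<comment> \<open>With one vertex on each side the \<open>F1\<close> and \<open>F2\<close> edges
    would coincide. Otherwise the path with two vertices supplies the third side of the
    triangle.\<close>
  then have "length P \<le> 1 \<and> length Q \<le> 1 \<or> length P = 2 \<and> length Q = 1 \<or> length P = 1 \<and> length Q = 2"
    using ne[folded length_greater_0_conv] by linarith
  then show ?thesis
  proof (elim disjE)
    assume "length P \<le> 1 \<and> length Q \<le> 1"
    then have "{hd P, hd Q} = {last P, last Q}" using ne by (cases P; cases Q) auto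
    then show ?thesis using F1 F2 F(3) by auto
  next
    assume "length P = 2 \<and> length Q = 1"
    then obtain x y z where "P = [y, z]" "Q = [x]"
      by (auto simp: length_Suc_conv numeral_2_eq_2)
    then show ?thesis using F1 F2 P
      by (auto simp: is_path_successively insert_commute)
  next
    assume "length P = 1 \<and> length Q = 2"
    then obtain x y z where "P = [x]" "Q = [y, z]"
      by (auto simp: length_Suc_conv numeral_2_eq_2)
    then show ?thesis using F1 F2 Q
      by (auto simp: is_path_successively)
  qed
qed

section \<open>The cut belonging to a separator path\<close>

text \<open>Before its first use of the new edge, a walk from \<open>u\<close> has reached
  \<open>a\<close> or \<open>b\<close>.\<close>

lemma conn_insert_edge:
  assumes "conn V (insert {a, b} E) u v"
  shows "conn V E u v \<or> conn V E u a \<or> conn V E u b"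
  using assms
proof (induction rule: conn_induct)
  case (step x y)
  show ?case
  proof (cases "{x, y} \<in> E")
    case True
    then show ?thesis using step by (blast intro: conn_trans conn_edge)
  next
    case False
    then have "x = a \<or> x = b" using step by (auto simp: doubleton_eq_iff)
    then show ?thesis using step by blast
  qed
qed simp

text \<open>A walk to \<open>a\<close> either avoids \<open>{a, b}\<close> or reaches one of its
  ends without using it. Were both ends joined without this edge, all vertices would be.\<close>

lemma bridge_two_components:
  assumes "\<not> connected_graph V E" "connected_graph V (insert {a, b} E)" "a \<in> V"
  shows "\<not> conn V E a b" "x \<in> V \<Longrightarrow> conn V E a x \<or> conn V E b x"
proof -
  have *: "conn V E a x \<or> conn V E b x" if "x \<in> V" for x
    using assms(2,3) that conn_insert_edge[of V a b E x a]
    by (auto simp: connected_graph_iff_conn intro: conn_sym)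
  then show "x \<in> V \<Longrightarrow> conn V E a x \<or> conn V E b x" .
  show "\<not> conn V E a b"
  proof
    assume "conn V E a b"
    then have "conn V E a x" if "x \<in> V" for x using * that conn_trans by metis
    then have "connected_graph V E"
      using assms(3) unfolding connected_graph_iff_conn by (metis conn_sym conn_trans empty_iff)
    then show False using assms(1) by simp
  qed
qed

text \<open>All vertices on a walk from \<open>u\<close> are reachable from \<open>u\<close>, so the
  walk never leaves the component.\<close>

lemma conn_component:
  assumes "conn V E u v" "u \<in> V" "E \<subseteq> E'"
  shows "conn {x \<in> V. conn V E u x} E' u v"
  using assms(1)
proof (induction rule: conn_induct)
  case (step x y)
  then have "conn V E u y" by (blast intro: conn_trans conn_edge)
  then have "conn {x \<in> V. conn V E u x} E' x y"
    using step assms by (intro conn_edge) auto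
  then show ?case using step conn_trans by metis
qed simp

lemma distinct_edge_eq_iff:
  assumes "distinct r" "Suc i < length r" "Suc j < length r"
  shows "{r ! i, r ! Suc i} = {r ! j, r ! Suc j} \<longleftrightarrow> i = j"
  using assms by (auto simp: doubleton_eq_iff nth_eq_iff_index_eq)

lemma skip_not_path_edge:
  assumes "distinct r" "i + 2 < length r"
  shows "{r ! i, r ! (i + 2)} \<notin> path_edges r"
  using assms by (auto simp: path_edges_def doubleton_eq_iff nth_eq_iff_index_eq)

text \<open>A vertex of a path without repetitions meets only the edge before it and the edge after
  it, so \<open>x\<close> is the middle of three successive entries.\<close>

lemma path_edges_through:
  assumes "distinct r" "{x, y} \<in> path_edges r" "{x, z} \<in> path_edges r" "y \<noteq> z"
  obtains i where "i + 2 < length r" "x = r ! Suc i" "{y, z} = {r ! i, r ! (i + 2)}"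
    "y = r ! i \<and> z = r ! (i + 2) \<or> z = r ! i \<and> y = r ! (i + 2)"
proof -
  obtain i j where i: "Suc i < length r" "{x, y} = {r ! i, r ! Suc i}"
    and j: "Suc j < length r" "{x, z} = {r ! j, r ! Suc j}"
    using assms(2,3) by (auto simp: path_edges_def)
  then have "j = Suc i \<and> x = r ! Suc i \<and> y = r ! i \<and> z = r ! (i + 2) \<or>
      i = Suc j \<and> x = r ! Suc j \<and> z = r ! j \<and> y = r ! (j + 2)"
    using assms(1,4) by (auto simp: doubleton_eq_iff nth_eq_iff_index_eq)
  then show thesis
    using that i j by (elim disjE) auto
qed

lemma is_path_subpath:
  assumes "is_path V E r" "i \<le> j" "j < length r"
  shows "is_path V E (subpath r i j)"
  using assms unfolding is_path_def subpath_def
  by (auto simp: nth_append subset_iff simp del: upt_Suc)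

lemma path_edges_subpath:
  assumes "i \<le> j" "j < length r"
  shows "path_edges (subpath r i j) = {{r ! m, r ! Suc m} | m. i \<le> m \<and> m < j}"
proof (intro set_eqI iffI)
  fix e assume "e \<in> path_edges (subpath r i j)"
  then obtain k where "Suc k < Suc j - i" "e = {r ! (i + k), r ! Suc (i + k)}"
    unfolding path_edges_def subpath_def by (auto simp del: upt_Suc)
  then show "e \<in> {{r ! m, r ! Suc m} | m. i \<le> m \<and> m < j}"
    by (intro CollectI exI[of _ "i + k"]) auto
next
  fix e assume "e \<in> {{r ! m, r ! Suc m} | m. i \<le> m \<and> m < j}"
  then obtain m where "i \<le> m" "m < j" "e = {r ! m, r ! Suc m}" by blast
  then show "e \<in> path_edges (subpath r i j)"
    unfolding path_edges_def subpath_def by (auto simp del: upt_Suc intro!: exI[of _ "m - i"])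
qed

text \<open>A contained path of smaller length differs from \<open>r\<close>, so minimality of
  \<open>r\<close> forbids it to separate.\<close>

lemma separator_path_proper_subpath:
  assumes "separator_path V E r" "i \<le> j" "j < length r" "Suc j - i < length r"
  shows "connected_graph V (E - path_edges (subpath r i j))"
proof -
  have "length (subpath r i j) \<noteq> length r"
    using assms by (auto simp: subpath_def simp del: upt_Suc)
  then have "\<not> separating V E (subpath r i j)"
    using assms unfolding separator_path_def contains_path_def by metis
  then show ?thesis
    using assms is_path_subpath[of V E r i j]
    unfolding separating_def separator_path_def simple_path_def by metis
qed

text \<open>The cut \<open>(A, V - A)\<close> consists of the two components left by the removal of the path.\<close>

lemma separator_path_cut:
  assumes chordal: "chordal_graph V E" and sep: "separator_path V E r" and len: "3 \<le> length r"
  obtains A where "A \<subseteq> V"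
    "\<And>x y. x \<in> A \<Longrightarrow> y \<in> V - A \<Longrightarrow> {x, y} \<in> E \<Longrightarrow> {x, y} \<in> path_edges r"
    "\<And>i. Suc i < length r \<Longrightarrow> r ! i \<in> A \<longleftrightarrow> r ! Suc i \<notin> A"
    "r ! 0 \<in> A"
    "\<And>x y. x \<in> V - A \<Longrightarrow> y \<in> V - A \<Longrightarrow> conn (V - A) E x y"
    "\<And>i. i + 2 < length r \<Longrightarrow> {r ! i, r ! (i + 2)} \<in> E"
proof -
  define E' where "E' = E - path_edges r"
  \<comment> \<open>The edges of \<open>r\<close> are then numbered from 0 to \<open>n\<close>, and
    the last one joins \<open>r ! n\<close> and \<open>r ! Suc n\<close>.\<close>
  define n where "n = length r - 2"
  have lr: "length r = n + 2" "n \<ge> 1" using len by (auto simp: n_def)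
  have path: "is_path V E r" and dist: "distinct r" and nconn: "\<not> connected_graph V E'"
    using sep by (auto simp: separator_path_def simple_path_def separating_def E'_def)
  have rV: "r ! i \<in> V" if "i < n + 2" for i
    using path that lr by (auto simp: is_path_def)
  have rE: "{r ! i, r ! Suc i} \<in> E" if "i \<le> n" for i
    using path that lr by (auto simp: is_path_def)
  have pe: "path_edges r = {{r ! m, r ! Suc m} | m. m \<le> n}"
    using lr by (auto simp: path_edges_def less_Suc_eq_le)
  have inj: "{r ! i, r ! Suc i} = {r ! j, r ! Suc j} \<longleftrightarrow> i = j" if "i \<le> n" "j \<le> n" for i j
    using distinct_edge_eq_iff[OF dist, of i j] that lr by auto
  \<comment> \<open>Deleting all edges of \<open>r\<close> but the last does not disconnect, so the
    last edge is a bridge between exactly two components of \<open>E'\<close>. Below, the same is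
    done for the first edge.\<close>
  have "E - path_edges (subpath r 0 n) = insert {r ! n, r ! Suc n} E'"
    using lr rE[of n] inj[of n] unfolding E'_def pe
    by (subst path_edges_subpath) (auto simp: le_less)
  then have "connected_graph V (insert {r ! n, r ! Suc n} E')"
    using separator_path_proper_subpath[OF sep, of 0 n] lr by auto
  note last = bridge_two_components[OF nconn this rV]
  have *: "m = 0 \<or> Suc 0 \<le> m" for m by auto
  have "E - path_edges (subpath r 1 (Suc n)) = insert {r ! 0, r ! Suc 0} E'"
    using lr rE[of 0] inj[of 0] * unfolding E'_def pe
    by (subst path_edges_subpath) (auto simp: less_Suc_eq_le)
  then have "connected_graph V (insert {r ! 0, r ! Suc 0} E')"
    using separator_path_proper_subpath[OF sep, of 1 "Suc n"] lr by auto
  note first = bridge_two_components[OF nconn this rV]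
  \<comment> \<open>The two components are those of the ends of the first edge; \<open>A\<close> is
    the one containing \<open>r ! 0\<close>, its complement the one containing
    \<open>r ! 1\<close>.\<close>
  define A where "A = {v \<in> V. conn V E' (r ! 0) v}"
  have B: "V - A = {v \<in> V. conn V E' (r ! 1) v}"
    using first unfolding A_def by (auto dest: conn_sym intro: conn_trans)
  have "E' \<subseteq> E" by (auto simp: E'_def)
  have connA: "conn A E x y" if "x \<in> A" "y \<in> A" for x y
    using that conn_component[OF _ rV \<open>E' \<subseteq> E\<close>, of 0] unfolding A_def
    by (auto intro: conn_trans conn_sym)
  have connB: "conn (V - A) E x y" if "x \<in> V - A" "y \<in> V - A" for x y
    using that conn_component[OF _ rV \<open>E' \<subseteq> E\<close>, of 1] unfolding B
    by (auto intro: conn_trans conn_sym)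
  have cross: "{x, y} \<in> path_edges r" if "x \<in> A" "y \<in> V - A" "{x, y} \<in> E" for x y
  proof (rule ccontr)
    assume "{x, y} \<notin> path_edges r"
    then have "conn V E' x y"
      using that by (intro conn_edge) (auto simp: E'_def A_def)
    then show False using that by (auto simp: A_def intro: conn_trans)
  qed
  have r0: "r ! 0 \<in> A" "r ! 1 \<in> V - A"
    using rV[of 0] rV[of 1] lr unfolding B by (auto simp: A_def)
  have lastcross: "r ! n \<in> A \<longleftrightarrow> r ! Suc n \<notin> A"
  proof -
    have "\<not> (r ! n \<in> A \<and> r ! Suc n \<in> A)"
      using last(1) unfolding A_def by (auto intro: conn_trans conn_sym)
    moreover have "\<not> (r ! n \<in> V - A \<and> r ! Suc n \<in> V - A)"
      using last(1) unfolding B by (auto intro: conn_trans conn_sym)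
    ultimately show ?thesis using rV[of n] rV[of "Suc n"] by auto
  qed
  obtain a b where ab: "{a, b} = {r ! n, r ! Suc n}" "a \<in> A" "b \<in> V - A"
    using lastcross rV[of n] rV[of "Suc n"] by (cases "r ! n \<in> A") (auto simp: insert_commute)
  \<comment> \<open>The crossing edges are split after index \<open>i\<close>, with the first edge
    in \<open>F1\<close> and the last in \<open>F2\<close>. Two edges of the resulting triangle
    share a vertex across the split, so they have indices \<open>i\<close> and \<open>i + 1\<close>,
    and the third side is the wanted edge.\<close>
  have skip: "{r ! i, r ! (i + 2)} \<in> E" if "i + 2 < length r" for i
  proof -
    define F1 where "F1 = {{r ! m, r ! Suc m} | m. m \<le> i}"
    define F2 where "F2 = {{r ! m, r ! Suc m} | m. i < m \<and> m \<le> n}"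
    have "i < n" using that lr by auto
    have "F1 \<union> F2 = path_edges r"
      unfolding F1_def F2_def pe using \<open>i < n\<close> by force
    have "\<exists>x y z. {x, y} \<in> F1 \<and> {x, z} \<in> F2 \<and> {y, z} \<in> E"
    proof (rule bond_triangle[OF chordal, of A "V - A"])
      show "F1 \<subseteq> E" "F2 \<subseteq> E"
        using rE \<open>i < n\<close> by (auto simp: F1_def F2_def)
      show "F1 \<inter> F2 = {}"
        using inj \<open>i < n\<close> unfolding F1_def F2_def by fastforce
      show "{r ! 0, r ! 1} \<in> F1" "{a, b} \<in> F2"
        using \<open>i < n\<close> ab by (auto simp: F1_def F2_def)
      show "{x, y} \<in> F1 \<union> F2" if "x \<in> A" "y \<in> V - A" "{x, y} \<in> E" for x y
        using cross[OF that] \<open>F1 \<union> F2 = path_edges r\<close> by simp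
    qed (use connA connB r0 ab in \<open>auto simp: A_def\<close>)
    then obtain x y z k l where k: "k \<le> i" "{x, y} = {r ! k, r ! Suc k}"
      and l: "i < l" "l \<le> n" "{x, z} = {r ! l, r ! Suc l}" and yz: "{y, z} \<in> E"
      unfolding F1_def F2_def by blast
    then have "k = i \<and> y = r ! i \<and> z = r ! (i + 2)"
      using dist lr by (auto simp: doubleton_eq_iff nth_eq_iff_index_eq)
    then show ?thesis using yz by simp
  qed
  \<comment> \<open>The edge between entries two apart is not an edge of \<open>r\<close>, so it
    cannot cross the cut: these entries lie on the same side, and alternation propagates from the
    first edge.\<close>
  have alt: "r ! i \<in> A \<longleftrightarrow> r ! Suc i \<notin> A" if "Suc i < length r" for i
    using that
  proof (induction i)
    case 0
    then show ?case using r0 by simp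
  next
    case (Suc i)
    have "{r ! i, r ! Suc (Suc i)} \<notin> path_edges r" "{r ! i, r ! Suc (Suc i)} \<in> E"
      using skip_not_path_edge[OF dist, of i] skip[of i] Suc by auto
    then have "r ! i \<in> A \<longleftrightarrow> r ! Suc (Suc i) \<in> A"
      using cross[of "r ! i" "r ! Suc (Suc i)"] cross[of "r ! Suc (Suc i)" "r ! i"]
        rV[of i] rV[of "Suc (Suc i)"] lr Suc by (auto simp: insert_commute)
    then show ?case using Suc by auto
  qed
  show thesis
    by (rule that[of A]) (use cross alt r0 connB skip in \<open>auto simp: A_def\<close>)
qed

section \<open>Usefulness and propagation along a path\<close>

text \<open>Two distinct edges at \<open>x\<close> are consecutive on \<open>r\<close>. This frees
  usefulness from indices and from the direction of \<open>r\<close>, so that it can be compared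
  between two paths.\<close>

lemma useful_triangle:
  assumes "distinct r" "useful L r" "{x, y} \<in> path_edges r" "{x, z} \<in> path_edges r" "y \<noteq> z"
  shows "L {x, y} + L {x, z} < L {y, z}"
proof -
  obtain i where i: "i + 2 < length r" "x = r ! Suc i" "{y, z} = {r ! i, r ! (i + 2)}"
    "y = r ! i \<and> z = r ! (i + 2) \<or> z = r ! i \<and> y = r ! (i + 2)"
    using path_edges_through[OF assms(1,3,4,5)] .
  have "path_length L (subpath r i (i + 2)) = L {r ! i, r ! Suc i} + L {r ! Suc i, r ! (i + 2)}"
    by (simp add: path_length_def subpath_def numeral_2_eq_2 upt_rec[of i] upt_rec[of "Suc i"]
        upt_rec[of "Suc (Suc i)"])
  then show ?thesis
    using assms(2) i unfolding useful_def by (auto simp: insert_commute add.commute)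
qed

text \<open>Membership in \<open>F\<close> passes between consecutive edges both forwards and
  backwards, so one edge in \<open>F\<close> brings in all others by induction on the index.\<close>

lemma path_edges_subset_if_step:
  assumes "distinct r" "{x0, y0} \<in> path_edges r" "{x0, y0} \<in> F"
    and step: "\<And>x y z. {x, y} \<in> path_edges r \<Longrightarrow> {x, z} \<in> path_edges r \<Longrightarrow> y \<noteq> z \<Longrightarrow>
      {x, y} \<in> F \<Longrightarrow> {x, z} \<in> F"
  shows "path_edges r \<subseteq> F"
proof -
  obtain i where i: "Suc i < length r" "{r ! i, r ! Suc i} \<in> F"
    using assms(2,3) by (auto simp: path_edges_def)
  have step': "{r ! m, r ! Suc m} \<in> F \<longleftrightarrow> {r ! Suc m, r ! Suc (Suc m)} \<in> F"
    if "Suc (Suc m) < length r" for m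
  proof -
    have swap: "{r ! m, r ! Suc m} = {r ! Suc m, r ! m}" by (rule insert_commute)
    have 1: "{r ! Suc m, r ! m} \<in> path_edges r"
      unfolding swap[symmetric] using that by (simp add: path_edges_nth)
    have 2: "{r ! Suc m, r ! Suc (Suc m)} \<in> path_edges r"
      using that by (simp add: path_edges_nth)
    have 3: "r ! m \<noteq> r ! Suc (Suc m)"
      using that assms(1) by (simp add: nth_eq_iff_index_eq)
    show ?thesis
      unfolding swap using step[OF 1 2 3] step[OF 2 1 3[symmetric]] by blast
  qed
  have "{r ! m, r ! Suc m} \<in> F \<longleftrightarrow> {r ! 0, r ! Suc 0} \<in> F" if "Suc m < length r" for m
    using that
  proof (induction m)
    case (Suc m)
    then show ?case using step'[of m] by simp
  qed simp
  then have "{r ! m, r ! Suc m} \<in> F" if "Suc m < length r" for m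
    using i that by blast
  then show ?thesis
    by (auto simp: path_edges_def)
qed

section \<open>Recovering a path from its edges\<close>

text \<open>The first vertex occurs only once, so it lies on a single edge; this edge determines the
  second vertex and can be peeled off on both sides.\<close>

lemma path_edges_hd_eq:
  assumes "distinct p" "distinct q" "path_edges p = path_edges q" "hd p = hd q"
    "p \<noteq> []" "q \<noteq> []"
  shows "p = q"
  using assms
proof (induction p arbitrary: q)
  case (Cons x p)
  obtain q' where q: "q = x # q'" using Cons.prems by (cases q) auto
  have empty: "path_edges [x] = {}" by (auto simp: path_edges_def)
  show ?case
  proof (cases p)
    case Nil
    then show ?thesis
      using Cons.prems q empty by (cases q') (auto simp: path_edges_Cons_Cons)
  next
    case p: (Cons y ys)
    then obtain z zs where q': "q' = z # zs"
      using Cons.prems q empty by (cases q') (auto simp: path_edges_Cons_Cons)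
    have x: "x \<notin> \<Union> (path_edges p)" "x \<notin> \<Union> (path_edges q')"
      using path_edges_subset_set[of _ p] path_edges_subset_set[of _ q'] Cons.prems q by auto
    have eq: "insert {x, y} (path_edges p) = insert {x, z} (path_edges q')"
      using Cons.prems q q' p by (simp add: path_edges_Cons_Cons)
    have nin: "{x, y} \<notin> path_edges p" "{x, y} \<notin> path_edges q'" using x by blast+
    have "{x, y} \<in> insert {x, z} (path_edges q')" using eq by (metis insertI1)
    then have "{x, y} = {x, z}" using nin by simp
    moreover have "path_edges p = path_edges q'"
      using eq nin insert_ident unfolding calculation[symmetric] by metis
    ultimately have "p = q'"
      using Cons.IH[of q'] Cons.prems p q q' by (auto simp: doubleton_eq_iff)
    then show ?thesis using q by simp
  qed
qed simp

text \<open>An inner vertex of \<open>q\<close> lies on two edges, whereas \<open>p ! 0\<close> lies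
  on only one. Hence \<open>p\<close> starts at an end of \<open>q\<close>, and the comparison from
  a common first vertex applies to \<open>q\<close> or to \<open>rev q\<close>.\<close>

lemma path_edges_eq:
  assumes "distinct p" "distinct q" "path_edges p = path_edges q" "2 \<le> length p" "2 \<le> length q"
  shows "p = q \<or> p = rev q"
proof -
  have ne: "p \<noteq> []" "q \<noteq> []" using assms by auto
  have p0: "{p ! 0, p ! 1} \<in> path_edges q"
    using path_edges_nth[of 0 p] assms by auto
  then have "p ! 0 \<in> set q" using path_edges_subset_set by fastforce
  then obtain j where j: "j < length q" "q ! j = p ! 0" by (auto simp: in_set_conv_nth)
  have "j = 0 \<or> j = length q - 1"
  proof (rule ccontr)
    assume "\<not> ?thesis"
    then obtain i where i: "j = Suc i" "i + 2 < length q" using j by (cases j) auto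
    then have "{p ! 0, q ! i} \<in> path_edges p" "{p ! 0, q ! (i + 2)} \<in> path_edges p"
      using j assms(3) path_edges_nth[of i q] path_edges_nth[of "Suc i" q] by (auto simp: insert_commute)
    moreover have "q ! i \<noteq> q ! (i + 2)" using assms i by (auto simp: nth_eq_iff_index_eq)
    ultimately obtain k where "k + 2 < length p" "p ! 0 = p ! Suc k"
      using path_edges_through[OF assms(1)] by metis
    then show False using nth_eq_iff_index_eq[OF assms(1), of 0 "Suc k"] ne by simp
  qed
  then have "hd p = hd q \<or> hd p = hd (rev q)"
    using j ne by (auto simp: hd_conv_nth hd_rev last_conv_nth)
  then show ?thesis
    using path_edges_hd_eq[of p q] path_edges_hd_eq[of p "rev q"] assms ne by auto
qed

section \<open>Traversal in both directions\<close>

text \<open>The traversing path is simple, so its initial piece up to the first vertex of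
  \<open>r\<close> avoids all later vertices of \<open>r\<close>.\<close>

lemma traversable_conn:
  assumes "traversable V E S T r"
  shows "conn (V - set (tl r)) E S (hd r)"
proof -
  obtain p i j where p: "is_path V E p" "distinct p" "hd p = S" "i \<le> j" "j < length p"
      "r = subpath p i j"
    using assms by (auto simp: traversable_def contains_path_def simple_path_def)
  have r: "r = p ! i # map ((!) p) [Suc i..<Suc j]"
    using p by (simp add: subpath_def upt_rec[of i] del: upt_Suc)
  let ?s = "take (Suc i) p"
  have "is_path V E ?s"
    using p by (auto simp: is_path_def dest: in_set_takeD)
  moreover have "set ?s \<inter> set (tl r) = {}"
  proof -
    have "set (tl r) \<subseteq> set (drop (Suc i) p)"
    proof
      fix x assume "x \<in> set (tl r)"
      then obtain k where "Suc i \<le> k" "k < Suc j" "x = p ! k"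
        unfolding r by (auto simp del: upt_Suc)
      then have "drop (Suc i) p ! (k - Suc i) = x" "k - Suc i < length (drop (Suc i) p)"
        using p(5) by auto
      then show "x \<in> set (drop (Suc i) p)" by (metis nth_mem)
    qed
    then show ?thesis
      using set_take_disj_set_drop_if_distinct[OF p(2), of "Suc i" "Suc i"] by blast
  qed
  ultimately have "is_path (V - set (tl r)) E ?s"
    by (auto simp: is_path_def)
  moreover have "hd ?s = S"
    using p(3,5) by (cases p) auto
  moreover have "last ?s = p ! i"
    using p(4,5) by (simp add: take_Suc_conv_app_nth)
  moreover have "hd r = p ! i"
    by (simp add: r)
  ultimately show ?thesis
    using is_path_imp_conn by metis
qed

lemma conn_mono: "conn V E u v \<Longrightarrow> V \<subseteq> W \<Longrightarrow> conn W E u v"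
  unfolding conn_def by (rule rtranclp_mono[THEN predicate2D, rotated]) auto

text \<open>Discarding the inner vertices of \<open>r\<close> from the side \<open>A\<close> leaves
  only the first and the last edge of \<open>r\<close> in the cut. A triangle containing both is
  impossible, since with at least four vertices on \<open>r\<close> these edges are
  disjoint.\<close>

lemma not_traversable_both_directions:
  assumes chordal: "chordal_graph V E" and sep: "separator_path V E r" and len: "4 \<le> length r"
    and trav: "traversable V E S T r" "traversable V E S T (rev r)"
  shows False
proof -
  have "3 \<le> length r" using len by simp
  obtain A where A: "A \<subseteq> V"
    and cross: "\<And>x y. x \<in> A \<Longrightarrow> y \<in> V - A \<Longrightarrow> {x, y} \<in> E \<Longrightarrow> {x, y} \<in> path_edges r"
    and alt: "\<And>i. Suc i < length r \<Longrightarrow> r ! i \<in> A \<longleftrightarrow> r ! Suc i \<notin> A"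
    and r0: "r ! 0 \<in> A"
    and connB: "\<And>x y. x \<in> V - A \<Longrightarrow> y \<in> V - A \<Longrightarrow> conn (V - A) E x y"
    using separator_path_cut[OF chordal sep \<open>3 \<le> length r\<close>] by metis
  define n where "n = length r - 2"
  have lr: "length r = n + 2" "n \<ge> 2" using len by (auto simp: n_def)
  have path: "is_path V E r" and dist: "distinct r"
    using sep by (auto simp: separator_path_def simple_path_def)
  have rV: "r ! i \<in> V" if "i < n + 2" for i
    using path that lr by (auto simp: is_path_def)
  have rE: "{r ! i, r ! Suc i} \<in> E" if "i \<le> n" for i
    using path that lr by (auto simp: is_path_def)
  define I where "I = {r ! i | i. 0 < i \<and> i \<le> n}"
  have I1: "I \<subseteq> set (tl r)"
  proof
    fix x assume "x \<in> I"
    then obtain i where i: "0 < i" "i \<le> n" "x = r ! i" by (auto simp: I_def)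
    then have "tl r ! (i - 1) = x" "i - 1 < length (tl r)"
      using lr by (auto simp: nth_tl)
    then show "x \<in> set (tl r)" by (metis nth_mem)
  qed
  have I2: "I \<subseteq> set (tl (rev r))"
  proof
    fix x assume "x \<in> I"
    then obtain i where i: "0 < i" "i \<le> n" "x = r ! i" by (auto simp: I_def)
    then have "tl (rev r) ! (n - i) = x" "n - i < length (tl (rev r))"
      using lr by (auto simp: nth_tl rev_nth)
    then show "x \<in> set (tl (rev r))" by (metis nth_mem)
  qed
  have "conn (V - I) E S (r ! 0)"
  proof -
    have "hd r = r ! 0" using lr by (intro hd_conv_nth) auto
    then show ?thesis
      using conn_mono[OF traversable_conn[OF trav(1)], of "V - I"] I1 by auto
  qed
  moreover have "conn (V - I) E S (r ! Suc n)"
  proof -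
    have "r \<noteq> []" using lr by auto
    then have "hd (rev r) = r ! Suc n" using lr by (simp add: hd_rev last_conv_nth)
    then show ?thesis
      using conn_mono[OF traversable_conn[OF trav(2)], of "V - I"] I2 by auto
  qed
  ultimately have "conn (V - I) E (r ! 0) (r ! Suc n)"
    by (metis conn_sym conn_trans)
  \<comment> \<open>Leaving \<open>A\<close> takes an edge of \<open>r\<close>, and every edge of
    \<open>r\<close> has an inner vertex as an end. A walk that avoids \<open>I\<close> and starts
    at \<open>r ! 0\<close> therefore stays in \<open>A\<close>.\<close>
  then have connA: "conn (A - I) E (r ! 0) (r ! Suc n) \<and> r ! Suc n \<in> A"
  proof (induction rule: conn_induct)
    case (step x y)
    have "y \<in> A"
    proof (rule ccontr)
      assume "y \<notin> A"
      then obtain i where "i \<le> n" "{x, y} = {r ! i, r ! Suc i}"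
        using step cross[of x y] lr by (auto simp: path_edges_def less_Suc_eq_le)
      moreover have "r ! i \<in> I \<or> r ! Suc i \<in> I"
        using \<open>i \<le> n\<close> lr by (cases i) (auto simp: I_def)
      ultimately show False using step by (auto simp: doubleton_eq_iff)
    qed
    then show ?case using step conn_trans[of "A - I" E] conn_edge[of x y E "A - I"] by blast
  qed (use r0 in simp)
  have rI: "r ! 0 \<notin> I" "r ! Suc n \<notin> I"
    using dist lr by (auto simp: I_def nth_eq_iff_index_eq)
  have rB: "r ! 1 \<in> V - A" "r ! n \<in> V - A"
    using alt[of 0] alt[of n] r0 connA rV[of 1] rV[of n] lr by auto
  \<comment> \<open>Both ends of \<open>r\<close> lie in \<open>A\<close>, so by alternation
    \<open>r ! 1\<close> and \<open>r ! n\<close> lie on the other side. Each of the two edges is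
    written with its end in \<open>A\<close> first.\<close>
  have "\<exists>x y z. {x, y} \<in> {{r ! 0, r ! 1}} \<and> {x, z} \<in> {{r ! Suc n, r ! n}} \<and> {y, z} \<in> E"
  proof (rule bond_triangle[OF chordal, of "A - I" "V - A"])
    show "conn (V - A) E (r ! 1) (r ! n)" using connB rB by blast
    show "{{r ! 0, r ! 1}} \<inter> {{r ! Suc n, r ! n}} = {}"
      using dist lr by (auto simp: doubleton_eq_iff nth_eq_iff_index_eq)
    show "{x, y} \<in> {{r ! 0, r ! 1}} \<union> {{r ! Suc n, r ! n}}"
      if xy: "x \<in> A - I" "y \<in> V - A" "{x, y} \<in> E" for x y
    proof -
      obtain i where i: "i \<le> n" "{x, y} = {r ! i, r ! Suc i}"
        using cross[of x y] xy lr by (auto simp: path_edges_def less_Suc_eq_le)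
      moreover have "i = 0 \<or> i = n"
      proof (rule ccontr)
        assume "\<not> ?thesis"
        then have "r ! i \<in> I" "r ! Suc i \<in> I" using i by (auto simp: I_def)
        then show False using i xy by (auto simp: doubleton_eq_iff)
      qed
      ultimately show ?thesis by (auto simp: insert_commute)
    qed
  qed (use A r0 rI rB connA rE[of 0] rE[of n] in \<open>auto simp: insert_commute\<close>)
  then show False
    using dist lr by (auto simp: doubleton_eq_iff nth_eq_iff_index_eq)
qed

section \<open>Shared edges and the conclusion\<close>

text \<open>Two consecutive edges of \<open>r\<close> lie in a triangle, and \<open>q\<close> crosses each triangle in zero or two
  edges. If \<open>q\<close> used only one of the two edges of \<open>r\<close>, it would also use the third side of the
  triangle, and the usefulness inequalities of \<open>q\<close> and \<open>r\<close> would contradict each other.\<close>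

lemma shared_edge_subset:
  assumes chordal: "chordal_graph V E" and pos: "\<forall>e\<in>E. 0 < L e"
    and r: "separator_path V E r" "useful L r" "3 \<le> length r"
    and q: "separator_path V E q" "useful L q" "3 \<le> length q"
    and "path_edges q \<inter> path_edges r \<noteq> {}"
  shows "path_edges r \<subseteq> path_edges q"
proof -
  have dr: "distinct r" and dq: "distinct q" and qE: "path_edges q \<subseteq> E" and rE: "path_edges r \<subseteq> E"
      and qV: "set q \<subseteq> V" and rV: "set r \<subseteq> V"
    using r q is_path_edges by (auto simp: separator_path_def simple_path_def is_path_def)
  obtain A where A: "A \<subseteq> V"
    and cross: "\<And>x y. x \<in> A \<Longrightarrow> y \<in> V - A \<Longrightarrow> {x, y} \<in> E \<Longrightarrow> {x, y} \<in> path_edges q"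
    and alt: "\<And>i. Suc i < length q \<Longrightarrow> q ! i \<in> A \<longleftrightarrow> q ! Suc i \<notin> A"
    using separator_path_cut[OF chordal q(1,3)] by metis
  have altE: "x \<in> A \<longleftrightarrow> y \<notin> A" if "{x, y} \<in> path_edges q" for x y
    using that alt by (auto simp: path_edges_def doubleton_eq_iff)
  have skip: "\<And>i. i + 2 < length r \<Longrightarrow> {r ! i, r ! (i + 2)} \<in> E"
    using separator_path_cut[OF chordal r(1,3)] by metis
  obtain x0 y0 where xy0: "{x0, y0} \<in> path_edges r" "{x0, y0} \<in> path_edges q"
    using assms(9) by (auto simp: path_edges_def)
  show ?thesis
  proof (rule path_edges_subset_if_step[OF dr xy0])
    fix x y z assume xy: "{x, y} \<in> path_edges r" and xz: "{x, z} \<in> path_edges r" and "y \<noteq> z"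
      and xyq: "{x, y} \<in> path_edges q"
    have yz: "{y, z} \<in> E"
      using path_edges_through[OF dr xy xz \<open>y \<noteq> z\<close>] skip by metis
    have V: "x \<in> V" "y \<in> V" "z \<in> V"
      using path_edges_subset_set[OF xy] path_edges_subset_set[OF xz] rV by auto
    have crossE: "{u, v} \<in> path_edges q" if "u \<in> A \<longleftrightarrow> v \<notin> A" "{u, v} \<in> E" "u \<in> V" "v \<in> V" for u v
      using that cross[of u v] cross[of v u] by (auto simp: insert_commute)
    show "{x, z} \<in> path_edges q"
    proof (cases "x \<in> A \<longleftrightarrow> z \<in> A")
      case True
      \<comment> \<open>As an edge of \<open>q\<close>, \<open>{x, y}\<close> crosses the cut of
        \<open>q\<close>; with \<open>z\<close> on the side of \<open>x\<close>, the side
        \<open>{y, z}\<close> crosses it too.\<close>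
      then have "{y, z} \<in> path_edges q"
        using altE[OF xyq] crossE yz V by blast
      moreover have "card {x, z} = 2"
        using chordal xz rE by (auto simp: chordal_graph_def simple_graph_def)
      then have "x \<noteq> z" by auto
      \<comment> \<open>Usefulness of \<open>q\<close> at \<open>y\<close> and of \<open>r\<close>
        at \<open>x\<close> add up to \<open>2 * L {x, y} < 0\<close>, against positivity.\<close>
      ultimately have "L {y, x} + L {y, z} < L {x, z}"
        using useful_triangle[OF dq q(2), of y x z] xyq by (auto simp: insert_commute)
      moreover have "L {x, y} + L {x, z} < L {y, z}"
        by (rule useful_triangle[OF dr r(2) xy xz \<open>y \<noteq> z\<close>])
      moreover have "0 < L {x, y}" using pos xy rE by auto
      ultimately show ?thesis by (simp add: insert_commute)
    next
      case False
      then show ?thesis using crossE V xz rE by blast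
    qed
  qed
qed

theorem theorem7:
  fixes V :: "'a set" and E :: "'a set set" and L :: "'a set \<Rightarrow> real" and S T :: 'a
    and q r :: "'a list"
  assumes "chordal_graph V E"
    and "connected_graph V E"
    and "\<forall>e\<in>E. 0 < L e"
    and "unique_path_lengths V E L"
    and "S \<in> V" and "T \<in> V" and "S \<noteq> T"
    and "normal_separator_path V E L S T q"
    and "normal_separator_path V E L S T r"
    and "q \<noteq> r"
  shows "path_edges q \<inter> path_edges r = {}"
proof (rule ccontr)
  assume meet: "path_edges q \<inter> path_edges r \<noteq> {}"
  have q: "separator_path V E q" "useful L q" "4 \<le> length q" "traversable V E S T q"
    and r: "separator_path V E r" "useful L r" "4 \<le> length r" "traversable V E S T r"
    using assms(8,9) by (auto simp: normal_separator_path_def)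
  \<comment> \<open>Propagation is applied twice, with the roles of \<open>q\<close> and
    \<open>r\<close> exchanged.\<close>
  have "path_edges q = path_edges r"
    using shared_edge_subset[OF assms(1,3) r(1,2) _ q(1,2)] shared_edge_subset[OF assms(1,3) q(1,2) _ r(1,2)]
      meet q(3) r(3) by (auto simp: Int_commute)
  then have "q = rev r"
    using path_edges_eq[of q r] q r \<open>q \<noteq> r\<close> by (auto simp: separator_path_def simple_path_def)
  then show False
    using not_traversable_both_directions[OF assms(1) r(1,3,4)] q(4) by simp
qed

end
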